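(* For integers $m,n$, there is a configuration of a set $P$ of $m$ points and a set $L$ of $n$ lines in $\mathbb{R}^3$ such that (i) the number of lines of $L$ in any common plane is $s=O(1)$, and (ii) $I(P,L)=\Omega(m^{2/3}n^{1/2}+m+n)$.
   Context: For a finite set $P$ of points and a finite set $L$ of lines in $\mathbb{R}^3$, $I(P,L)$ denotes the number of pairs $(p,\ell)\in P\times L$ with $p\in\ell$. Asymptotic notation $O,\Omega$ is with respect to $m,n$, with implied constants independent of $m,n$. *)

theory Defs
  imports "HOL-Analysis.Analysis"
begin

definition is_line :: "(real ^ 3) set \<Rightarrow> bool" where
  "is_line l \<longleftrightarrow> affine l \<and> aff_dim l = 1"

definition is_plane :: "(real ^ 3) set \<Rightarrow> bool" where
  "is_plane H \<longleftrightarrow> affine H \<and> aff_dim H = 2"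

definition incidences :: "(real ^ 3) set \<Rightarrow> (real ^ 3) set set \<Rightarrow> nat" where
  "incidences P L = card {(p, l). p \<in> P \<and> l \<in> L \<and> p \<in> l}"

end

theory Submission imports Defs begin

text \<open>
  A point \<open>(x, y, z)\<close> is lifted to the quadric \<open>w = x z - y\<^sup>2\<close> in four-space, where the lines with
  spatial direction \<open>(1, t, t\<^sup>2)\<close> remain lines. Projecting along \<open>(0, \<lambda>, 1, \<mu>)\<close> gives points and
  lines in three-space. A plane there pulls back to a hyperplane containing the direction of
  projection. If that hyperplane is not parallel to the \<open>w\<close>-axis, it cuts the quadric in
  \<open>(x - x\<^sub>0) (z - z\<^sub>0) - (y - y\<^sub>0)\<^sup>2 = c\<close> with \<open>x\<^sub>0 = 2 \<lambda> y\<^sub>0 + \<mu>\<close>, and every line of our family on this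
  surface crosses \<open>x = x\<^sub>0\<close> where \<open>(y - y\<^sub>0)\<^sup>2 = - c\<close>, that is, at one of two values of \<open>y\<close>. Two
  lines with rational parameters and the same value would force \<open>x\<^sub>0\<close> and \<open>y\<^sub>0\<close> to be rational, which
  is impossible if \<open>\<mu> \<notin> \<rat> + \<rat> \<lambda>\<close>. If it is parallel to the \<open>w\<close>-axis, irrationality of \<open>\<lambda>\<close> leaves
  at most one rational line. So no plane contains three of them.

  The integer points of a \<open>k \<times> 2 k r \<times> 2 k r\<^sup>2\<close> box and lines with slopes \<open>t < r\<close> yield about
  \<open>k\<^sup>3 r\<^sup>3\<close> points, \<open>k\<^sup>2 r\<^sup>4\<close> lines and \<open>k\<^sup>3 r\<^sup>4\<close> incidences.
\<close>

section \<open>Counting incidences\<close>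

lemma incidences_eq_sum:
  assumes "finite P" "finite L"
  shows "incidences P L = (\<Sum>l\<in>L. card (P \<inter> l))"
proof -
  have "{(p, l). p \<in> P \<and> l \<in> L \<and> p \<in> l} = prod.swap ` (SIGMA l:L. P \<inter> l)"
    by (auto simp: image_iff)
  then have "incidences P L = card (SIGMA l:L. P \<inter> l)"
    by (simp add: incidences_def card_image)
  then show ?thesis
    using assms by simp
qed

lemma incidences_ge:
  assumes "finite P" "finite L" "\<And>l. l \<in> L \<Longrightarrow> q \<le> card (P \<inter> l)"
  shows "card L * q \<le> incidences P L"
  using sum_bounded_below[of L q "\<lambda>l. card (P \<inter> l)"] assms by (simp add: incidences_eq_sum)

lemma incidences_mono:
  assumes "finite P" "finite L" "P' \<subseteq> P" "L' \<subseteq> L"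
  shows "incidences P' L' \<le> incidences P L"
  unfolding incidences_def
proof (rule card_mono)
  show "finite {(p, l). p \<in> P \<and> l \<in> L \<and> p \<in> l}"
    by (rule finite_subset[of _ "P \<times> L"]) (use assms in auto)
qed (use assms in auto)

definition incidences_attainable :: "(real ^ 3) set set \<Rightarrow> nat \<Rightarrow> nat \<Rightarrow> nat \<Rightarrow> bool" where
  "incidences_attainable U m n N \<longleftrightarrow>
    (\<exists>P L. finite P \<and> card P = m \<and> finite L \<and> card L = n \<and> L \<subseteq> U \<and> N \<le> incidences P L)"

lemma finite_superset_of_card:
  assumes "infinite U" "finite A" "A \<subseteq> U" "card A \<le> n"
  obtains B where "A \<subseteq> B" "B \<subseteq> U" "finite B" "card B = n"
proof -
  have "infinite (U - A)" using assms by simp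
  then obtain D where D: "D \<subseteq> U - A" "finite D" "card D = n - card A"
    using infinite_arbitrarily_large by metis
  have "card (A \<union> D) = n"
    using D assms by (subst card_Un_disjoint) auto
  then show thesis using D assms by (intro that[of "A \<union> D"]) auto
qed

lemma incidences_attainableI:
  assumes "infinite U" "finite P" "card P \<le> m" "finite L" "card L \<le> n" "L \<subseteq> U"
    and "N \<le> incidences P L"
  shows "incidences_attainable U m n N"
proof -
  have "infinite (UNIV :: (real ^ 3) set)" by (rule infinite_UNIV_char_0)
  then obtain P' where P': "P \<subseteq> P'" "finite P'" "card P' = m"
    using finite_superset_of_card[of UNIV P m] assms by blast
  obtain L' where L': "L \<subseteq> L'" "L' \<subseteq> U" "finite L'" "card L' = n"
    using finite_superset_of_card[of U L n] assms by blast
  have "N \<le> incidences P' L'"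
    using incidences_mono[OF P'(2) L'(3) P'(1) L'(1)] assms by linarith
  with P' L' show ?thesis
    unfolding incidences_attainable_def by blast
qed

lemma incidences_attainable_points:
  assumes "infinite U" "l \<in> U" "infinite l" "n \<ge> 1"
  shows "incidences_attainable U m n m"
proof -
  obtain P where P: "P \<subseteq> l" "finite P" "card P = m"
    using infinite_arbitrarily_large[OF \<open>infinite l\<close>] by blast
  have "m \<le> incidences P {l}"
    using P by (simp add: incidences_eq_sum Int_absorb2)
  then show ?thesis
    using assms P by (intro incidences_attainableI[of U P m "{l}"]) auto
qed

lemma incidences_attainable_lines:
  assumes "infinite {l \<in> U. p \<in> l}" "m \<ge> 1"
  shows "incidences_attainable U m n n"
proof -
  obtain L where L: "L \<subseteq> {l \<in> U. p \<in> l}" "finite L" "card L = n"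
    using infinite_arbitrarily_large[OF assms(1)] by blast
  have "card L * 1 \<le> incidences {p} L"
    by (rule incidences_ge) (use L in auto)
  moreover have "infinite U"
    using assms(1) by (rule contrapos_nn) simp
  ultimately show ?thesis
    using assms L by (intro incidences_attainableI[of U "{p}" m L]) auto
qed

section \<open>Lines and planes in three-space\<close>

lemma is_line_range:
  fixes u d :: "real ^ 3"
  assumes "d \<noteq> 0"
  shows "is_line (range (\<lambda>x. u + x *\<^sub>R d))"
proof -
  have "range (\<lambda>x. u + x *\<^sub>R d) = affine hull {u, u + d}"
    by (simp add: affine_hull_2_alt)
  then show ?thesis
    using assms by (simp add: is_line_def)
qed

lemma infinite_is_line:
  assumes "is_line l"
  shows "infinite l"
proof
  assume "finite l"
  moreover have "connected l"
    using assms by (simp add: is_line_def affine_imp_convex convex_connected)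
  ultimately have "l = {} \<or> (\<exists>a. l = {a})"
    by (simp add: connected_finite_iff_sing)
  then show False
    using assms by (auto simp: is_line_def)
qed

lemma is_plane_hyperplane:
  assumes "is_plane H"
  obtains a b where "a \<noteq> 0" "H = {v. a \<bullet> v = b}"
proof -
  have hull: "affine hull H = H" and "aff_dim H = int (DIM(real ^ 3) - 1)"
    using assms by (simp_all add: is_plane_def)
  then have "\<exists>a b. a \<noteq> 0 \<and> H = {v. a \<bullet> v = b}"
    using aff_dim_eq_hyperplane[of H] unfolding hull by blast
  then show thesis
    using that by blast
qed

lemma range_subset_hyperplane_iff:
  fixes a u d :: "'a :: real_inner"
  shows "range (\<lambda>x. u + x *\<^sub>R d) \<subseteq> {v. a \<bullet> v = b} \<longleftrightarrow> a \<bullet> u = b \<and> a \<bullet> d = 0"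
proof
  assume "range (\<lambda>x. u + x *\<^sub>R d) \<subseteq> {v. a \<bullet> v = b}"
  then have "a \<bullet> (u + x *\<^sub>R d) = b" for x
    by blast
  then have on: "a \<bullet> u + x * (a \<bullet> d) = b" for x
    by (simp add: inner_add_right)
  show "a \<bullet> u = b \<and> a \<bullet> d = 0"
    using on[of 0] on[of 1] by simp
qed (auto simp: inner_add_right)

section \<open>Lines on a projected quadric\<close>

locale projected_quadric =
  fixes lam mu :: real
  assumes lam_irrational: "lam \<notin> \<rat>"
    and mu_irrational_over_lam: "a \<in> \<rat> \<Longrightarrow> b \<in> \<rat> \<Longrightarrow> mu \<noteq> a + b * lam"
begin

definition quadric_point :: "real \<Rightarrow> real \<Rightarrow> real \<Rightarrow> real ^ 3" where
  "quadric_point x y z = vector [x, y - lam * z, x * z - y\<^sup>2 - mu * z]"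

definition quadric_direction :: "real \<Rightarrow> real \<Rightarrow> real \<Rightarrow> real ^ 3" where
  "quadric_direction t y z = vector [1, t - lam * t\<^sup>2, z - 2 * y * t - mu * t\<^sup>2]"

definition quadric_line :: "real \<Rightarrow> real \<Rightarrow> real \<Rightarrow> (real ^ 3) set" where
  "quadric_line t y z = range (\<lambda>x. quadric_point 0 y z + x *\<^sub>R quadric_direction t y z)"

definition rational_lines :: "(real ^ 3) set set" where
  "rational_lines = {quadric_line t y z | t y z. t \<in> \<rat> \<and> y \<in> \<rat> \<and> z \<in> \<rat>}"

lemma quadric_point_nth_1 [simp]: "quadric_point x y z $ 1 = x"
  by (simp add: quadric_point_def)

lemma quadric_point_along_line:
  "quadric_point x (y + t * x) (z + t\<^sup>2 * x) = quadric_point 0 y z + x *\<^sub>R quadric_direction t y z"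
  by (simp add: quadric_point_def quadric_direction_def vec_eq_iff forall_3 algebra_simps
      power2_eq_square)

lemma quadric_point_in_line: "quadric_point x (y + t * x) (z + t\<^sup>2 * x) \<in> quadric_line t y z"
  unfolding quadric_line_def quadric_point_along_line by blast

lemma is_line_quadric_line: "is_line (quadric_line t y z)"
proof -
  have "quadric_direction t y z $ 1 = 1"
    by (simp add: quadric_direction_def)
  then have "quadric_direction t y z \<noteq> 0"
    by auto
  then show ?thesis
    unfolding quadric_line_def by (rule is_line_range)
qed

lemma rational_line_is_line: "l \<in> rational_lines \<Longrightarrow> is_line l"
  unfolding rational_lines_def using is_line_quadric_line by blast

lemma diff_lam_mult_inject:
  assumes "c \<in> \<rat>" "d \<in> \<rat>" "c' \<in> \<rat>" "d' \<in> \<rat>" and eq: "c - lam * d = c' - lam * d'"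
  shows "c = c' \<and> d = d'"
proof -
  have "d = d'"
  proof (rule ccontr)
    assume "d \<noteq> d'"
    then have "lam = (c - c') / (d - d')"
      using eq by (simp add: field_simps)
    then show False
      using lam_irrational assms by simp
  qed
  with eq show ?thesis by simp
qed

lemma quadric_line_inject:
  assumes rat: "t \<in> \<rat>" "y \<in> \<rat>" "z \<in> \<rat>" "t' \<in> \<rat>" "y' \<in> \<rat>" "z' \<in> \<rat>"
    and eq: "quadric_line t y z = quadric_line t' y' z'"
  shows "t = t' \<and> y = y' \<and> z = z'"
proof -
  have nth_2: "y - lam * z + x * (t - lam * t\<^sup>2) = y' - lam * z' + x * (t' - lam * t'\<^sup>2)" for x
  proof -
    have "quadric_point x (y + t * x) (z + t\<^sup>2 * x) \<in> quadric_line t' y' z'"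
      using quadric_point_in_line eq by blast
    then obtain u where u: "quadric_point x (y + t * x) (z + t\<^sup>2 * x)
        = quadric_point u (y' + t' * u) (z' + t'\<^sup>2 * u)"
      unfolding quadric_line_def quadric_point_along_line by blast
    have "x = u"
      using arg_cong[OF u, of "\<lambda>v. v $ 1"] by simp
    then show ?thesis
      using arg_cong[OF u, of "\<lambda>v. v $ 2"] by (simp add: quadric_point_def algebra_simps)
  qed
  have "y = y' \<and> z = z'"
    using nth_2[of 0] rat by (intro diff_lam_mult_inject) auto
  moreover have "t = t' \<and> t\<^sup>2 = t'\<^sup>2"
    using nth_2[of 0] nth_2[of 1] rat by (intro diff_lam_mult_inject) auto
  ultimately show ?thesis by simp
qed

lemma quadric_line_of_nat_inject [simp]:
  "quadric_line (real t) (real y) (real z) = quadric_line (real t') (real y') (real z') \<longleftrightarrow>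
    t = t' \<and> y = y' \<and> z = z'"
  using quadric_line_inject[of "real t" "real y" "real z" "real t'" "real y'" "real z'"] by auto

lemma quadric_line_of_nat_rational: "quadric_line (real t) (real y) (real z) \<in> rational_lines"
  unfolding rational_lines_def by (blast intro: Rats_of_nat)

lemma infinite_rational_lines_through_origin: "infinite {l \<in> rational_lines. 0 \<in> l}"
proof -
  define line where "line t = quadric_line (real t) (real 0) (real 0)" for t :: nat
  have "quadric_point 0 0 0 = 0"
    by (simp add: quadric_point_def vec_eq_iff forall_3)
  then have "0 \<in> line t" for t
    using quadric_point_in_line[of 0 0 "real t" 0] by (simp add: line_def)
  then have "range line \<subseteq> {l \<in> rational_lines. 0 \<in> l}"
    unfolding line_def using quadric_line_of_nat_rational by blast
  moreover have "inj line"
    unfolding line_def by (rule injI) (simp only: quadric_line_of_nat_inject)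
  then have "infinite (range line)"
    by (rule range_inj_infinite)
  ultimately show ?thesis
    by (rule infinite_super)
qed

lemma infinite_rational_lines: "infinite rational_lines"
  using infinite_rational_lines_through_origin by (rule contrapos_nn) simp

section \<open>Rational lines in a plane\<close>

definition rational_parameters :: "(real ^ 3) set \<Rightarrow> (real \<times> real \<times> real) set" where
  "rational_parameters H =
    {(t, y, z). t \<in> \<rat> \<and> y \<in> \<rat> \<and> z \<in> \<rat> \<and> quadric_line t y z \<subseteq> H}"

lemma quadric_line_subset_hyperplane_iff:
  "quadric_line t y z \<subseteq> {v. a \<bullet> v = b} \<longleftrightarrow>
    a $ 2 * (y - lam * z) - a $ 3 * (y\<^sup>2 + mu * z) = b \<and>
    a $ 1 + a $ 2 * (t - lam * t\<^sup>2) + a $ 3 * (z - 2 * y * t - mu * t\<^sup>2) = 0"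
  unfolding quadric_line_def range_subset_hyperplane_iff
  by (simp add: quadric_point_def quadric_direction_def inner_vec_def sum_3 algebra_simps)

lemma card_rational_parameters_vertical:
  assumes "a \<noteq> 0" "a $ 3 = 0"
  shows "finite (rational_parameters {v. a \<bullet> v = b})"
    and "card (rational_parameters {v. a \<bullet> v = b}) \<le> 1"
proof -
  let ?T = "rational_parameters {v. a \<bullet> v = b}"
  have "(t, y, z) = (t', y', z')" if "(t, y, z) \<in> ?T" "(t', y', z') \<in> ?T" for t y z t' y' z'
  proof -
    have rat: "t \<in> \<rat>" "y \<in> \<rat>" "z \<in> \<rat>" "t' \<in> \<rat>" "y' \<in> \<rat>" "z' \<in> \<rat>"
      and offset: "a $ 2 * (y - lam * z) = b" "a $ 2 * (y' - lam * z') = b"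
      and slope: "a $ 1 + a $ 2 * (t - lam * t\<^sup>2) = 0" "a $ 1 + a $ 2 * (t' - lam * t'\<^sup>2) = 0"
      using that assms(2)
      by (auto simp: rational_parameters_def quadric_line_subset_hyperplane_iff)
    have "a $ 2 \<noteq> 0"
      using assms slope by (auto simp: vec_eq_iff forall_3)
    then have "y - lam * z = y' - lam * z'" "t - lam * t\<^sup>2 = t' - lam * t'\<^sup>2"
      using offset slope by (metis mult_left_cancel, metis add_left_cancel mult_left_cancel)
    then show ?thesis
      using rat diff_lam_mult_inject[of y z y' z'] diff_lam_mult_inject[of t "t\<^sup>2" t' "t'\<^sup>2"] by simp
  qed
  then have unique: "p = q" if "p \<in> ?T" "q \<in> ?T" for p q
    using that by (metis prod_cases3)
  then have "?T = {} \<or> (\<exists>p. ?T = {p})" by blast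
  then show "finite ?T" and "card ?T \<le> 1" by auto
qed

lemma card_monic_quadratic_roots:
  fixes p q :: real
  shows "finite {x. x\<^sup>2 = p * x + q}" and "card {x. x\<^sup>2 = p * x + q} \<le> 2"
proof -
  have roots: "{x. x\<^sup>2 = p * x + q} = {x. poly [:- q, - p, 1:] x = 0}"
    by (auto simp: algebra_simps power2_eq_square)
  show "finite {x. x\<^sup>2 = p * x + q}"
    unfolding roots by (rule poly_roots_finite) simp
  show "card {x. x\<^sup>2 = p * x + q} \<le> 2"
    unfolding roots using card_poly_roots_bound[of "[:- q, - p, 1:]"] by simp
qed

lemma quadric_line_crossing_root:
  assumes "quadric_line t y z \<subseteq> {v. a \<bullet> v = b}" "a $ 3 = 1"
  defines "x0 \<equiv> mu + a $ 2 * lam"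
  shows "(y + t * x0)\<^sup>2 = a $ 2 * (y + t * x0) + (a $ 1 * x0 - b)"
proof -
  have z: "z = 2 * y * t - a $ 1 - a $ 2 * t + x0 * t\<^sup>2"
    and b: "b = a $ 2 * y - x0 * z - y\<^sup>2"
    using assms(1) unfolding quadric_line_subset_hyperplane_iff assms(2) x0_def
    by (simp_all add: algebra_simps)
  show ?thesis
    unfolding b z by (simp add: algebra_simps power2_eq_square)
qed

lemma quadric_line_crossing_inject:
  assumes "(t, y, z) \<in> rational_parameters {v. a \<bullet> v = b}"
    and "(t', y', z') \<in> rational_parameters {v. a \<bullet> v = b}"
    and "a $ 3 = 1"
  defines "x0 \<equiv> mu + a $ 2 * lam"
  assumes crossing: "y + t * x0 = y' + t' * x0"
  shows "t = t' \<and> y = y' \<and> z = z'"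
proof -
  have rat: "t \<in> \<rat>" "y \<in> \<rat>" "z \<in> \<rat>" "t' \<in> \<rat>" "y' \<in> \<rat>" "z' \<in> \<rat>"
    and z: "z = 2 * y * t - a $ 1 - a $ 2 * t + x0 * t\<^sup>2"
    and z': "z' = 2 * y' * t' - a $ 1 - a $ 2 * t' + x0 * t'\<^sup>2"
    using assms(1-3)
    by (auto simp: rational_parameters_def quadric_line_subset_hyperplane_iff x0_def algebra_simps)
  have "t = t'"
  proof (rule ccontr)
    assume "t \<noteq> t'"
    then have "x0 = (y' - y) / (t - t')"
      using crossing by (simp add: field_simps)
    then have x0: "x0 \<in> \<rat>"
      using rat by simp
    have "a $ 2 * (t - t') = 2 * y * t - 2 * y' * t' + x0 * (t\<^sup>2 - t'\<^sup>2) - (z - z')"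
      unfolding z z' by (simp add: algebra_simps)
    then have "a $ 2 = (2 * y * t - 2 * y' * t' + x0 * (t\<^sup>2 - t'\<^sup>2) - (z - z')) / (t - t')"
      using \<open>t \<noteq> t'\<close> by (simp add: field_simps)
    also have "\<dots> \<in> \<rat>"
      using rat x0 by simp
    finally have "mu \<noteq> x0 + (- (a $ 2)) * lam"
      using x0 by (intro mu_irrational_over_lam) auto
    then show False
      by (simp add: x0_def)
  qed
  with crossing z z' show ?thesis by simp
qed

lemma card_rational_parameters_nonvertical:
  assumes "a $ 3 = 1"
  shows "finite (rational_parameters {v. a \<bullet> v = b})"
    and "card (rational_parameters {v. a \<bullet> v = b}) \<le> 2"
proof -
  let ?T = "rational_parameters {v. a \<bullet> v = b}"
  define x0 where "x0 = mu + a $ 2 * lam"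
  define roots where "roots = {u. u\<^sup>2 = a $ 2 * u + (a $ 1 * x0 - b)}"
  define crossing where "crossing = (\<lambda>(t, y, z :: real). y + t * x0)"
  have finite_roots: "finite roots" and card_roots: "card roots \<le> 2"
    unfolding roots_def by (rule card_monic_quadratic_roots)+
  have inj: "inj_on crossing ?T"
  proof (rule inj_onI)
    fix p q assume pq: "p \<in> ?T" "q \<in> ?T" "crossing p = crossing q"
    obtain t y z t' y' z' where "p = (t, y, z)" "q = (t', y', z')"
      using prod_cases3 by metis
    with pq show "p = q"
      using quadric_line_crossing_inject[of t y z a b t' y' z'] assms
      by (simp add: crossing_def x0_def)
  qed
  have image: "crossing ` ?T \<subseteq> roots"
  proof (rule image_subsetI)
    fix p assume "p \<in> ?T"
    then obtain t y z where p: "p = (t, y, z)" and "quadric_line t y z \<subseteq> {v. a \<bullet> v = b}"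
      unfolding rational_parameters_def by blast
    then show "crossing p \<in> roots"
      using quadric_line_crossing_root[of t y z a b] assms
      by (simp add: crossing_def roots_def x0_def)
  qed
  show "finite ?T"
    using inj_on_finite[OF inj image finite_roots] .
  show "card ?T \<le> 2"
    using card_inj_on_le[OF inj image finite_roots] card_roots by linarith
qed

lemma card_rational_parameters_plane:
  assumes "is_plane H"
  shows "finite (rational_parameters H) \<and> card (rational_parameters H) \<le> 2"
proof -
  obtain a b where a: "a \<noteq> 0" and H: "H = {v. a \<bullet> v = b}"
    using is_plane_hyperplane[OF assms] .
  show ?thesis
  proof (cases "a $ 3 = 0")
    case True
    then show ?thesis
      using card_rational_parameters_vertical[OF a True, of b] unfolding H by linarith
  next
    case False
    define a' where "a' = a /\<^sub>R (a $ 3)"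
    have "H = {v. a' \<bullet> v = b / a $ 3}"
      using False unfolding H a'_def by (auto simp: field_simps)
    moreover have "a' $ 3 = 1"
      using False by (simp add: a'_def)
    ultimately show ?thesis
      using card_rational_parameters_nonvertical by simp
  qed
qed

lemma card_rational_lines_in_plane:
  assumes "L \<subseteq> rational_lines" "is_plane H"
  shows "card {l \<in> L. l \<subseteq> H} \<le> 2"
proof -
  let ?T = "rational_parameters H"
  have "{l \<in> L. l \<subseteq> H} \<subseteq> (\<lambda>(t, y, z). quadric_line t y z) ` ?T"
  proof
    fix l assume "l \<in> {l \<in> L. l \<subseteq> H}"
    then obtain t y z where "l = quadric_line t y z" "(t, y, z) \<in> ?T"
      using assms(1) unfolding rational_lines_def rational_parameters_def by blast
    then show "l \<in> (\<lambda>(t, y, z). quadric_line t y z) ` ?T"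
      by (intro image_eqI[of _ _ "(t, y, z)"]) simp_all
  qed
  then have "card {l \<in> L. l \<subseteq> H} \<le> card ?T"
    using card_rational_parameters_plane[OF assms(2)] by (meson surj_card_le)
  with card_rational_parameters_plane[OF assms(2)] show ?thesis by linarith
qed

section \<open>The grid configuration\<close>

definition grid_points :: "nat \<Rightarrow> nat \<Rightarrow> (real ^ 3) set" where
  "grid_points k r = (\<lambda>(x, y, z). quadric_point (real x) (real y) (real z)) `
    ({..<k} \<times> {..<2 * k * r} \<times> {..<2 * k * r\<^sup>2})"

definition grid_lines :: "nat \<Rightarrow> nat \<Rightarrow> (real ^ 3) set set" where
  "grid_lines k r = (\<lambda>(t, y, z). quadric_line (real t) (real y) (real z)) `
    ({..<r} \<times> {..<k * r} \<times> {..<k * r\<^sup>2})"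

lemma finite_grid_points: "finite (grid_points k r)"
  by (simp add: grid_points_def)

lemma finite_grid_lines: "finite (grid_lines k r)"
  by (simp add: grid_lines_def)

lemma card_grid_points_le: "card (grid_points k r) \<le> 4 * k ^ 3 * r ^ 3"
proof -
  have "card (grid_points k r) \<le> card ({..<k} \<times> {..<2 * k * r} \<times> {..<2 * k * r\<^sup>2})"
    unfolding grid_points_def by (rule card_image_le) simp
  also have "\<dots> = 4 * k ^ 3 * r ^ 3"
    by (simp add: card_cartesian_product power2_eq_square power3_eq_cube)
  finally show ?thesis .
qed

lemma card_grid_lines: "card (grid_lines k r) = k\<^sup>2 * r ^ 4"
proof -
  have "inj_on (\<lambda>(t, y, z). quadric_line (real t) (real y) (real z)) A" for A
    by (auto intro: inj_onI)
  then show ?thesis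
    unfolding grid_lines_def
    by (simp add: card_image card_cartesian_product eval_nat_numeral)
qed

lemma grid_lines_subset: "grid_lines k r \<subseteq> rational_lines"
  unfolding grid_lines_def using quadric_line_of_nat_rational by auto

lemma card_grid_points_on_line:
  assumes "l \<in> grid_lines k r"
  shows "k \<le> card (grid_points k r \<inter> l)"
proof -
  obtain t y z where l: "l = quadric_line (real t) (real y) (real z)"
    and bounds: "t < r" "y < k * r" "z < k * r\<^sup>2"
    using assms unfolding grid_lines_def by auto
  define point where
    "point x = quadric_point (real x) (real (y + t * x)) (real (z + t\<^sup>2 * x))" for x :: nat
  have "inj_on point {..<k}"
    by (rule inj_onI) (metis point_def quadric_point_nth_1 of_nat_eq_iff)
  moreover have "point x \<in> grid_points k r \<inter> l" if "x < k" for x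
  proof
    have "t * x \<le> k * r" "t\<^sup>2 * x \<le> k * r\<^sup>2"
      using mult_mono[of t r x k] mult_mono[of "t\<^sup>2" "r\<^sup>2" x k] power_mono[of t r 2] bounds that
      by (simp_all add: mult.commute)
    then have "(x, y + t * x, z + t\<^sup>2 * x) \<in> {..<k} \<times> {..<2 * k * r} \<times> {..<2 * k * r\<^sup>2}"
      using bounds that by simp
    then show "point x \<in> grid_points k r"
      unfolding grid_points_def point_def by force
    show "point x \<in> l"
      using quadric_point_in_line[of "real x" "real y" "real t" "real z"]
      by (simp add: l point_def)
  qed
  ultimately show ?thesis
    using card_inj_on_le[of point "{..<k}" "grid_points k r \<inter> l"] finite_grid_points by auto
qed

lemma incidences_attainable_grid:
  assumes "4 * k ^ 3 * r ^ 3 \<le> m" "k\<^sup>2 * r ^ 4 \<le> n"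
  shows "incidences_attainable rational_lines m n (k ^ 3 * r ^ 4)"
proof (rule incidences_attainableI[OF infinite_rational_lines])
  show "card (grid_points k r) \<le> m" "card (grid_lines k r) \<le> n"
    using assms card_grid_points_le[of k r] by (simp_all add: card_grid_lines)
  have "card (grid_lines k r) * k \<le> incidences (grid_points k r) (grid_lines k r)"
    by (intro incidences_ge finite_grid_points finite_grid_lines card_grid_points_on_line)
  then show "k ^ 3 * r ^ 4 \<le> incidences (grid_points k r) (grid_lines k r)"
    by (simp add: card_grid_lines eval_nat_numeral mult_ac)
qed (rule finite_grid_points finite_grid_lines grid_lines_subset)+

end

section \<open>The lower bound\<close>

lemma ex_projected_quadric: "\<exists>lam mu. projected_quadric lam mu"
proof -
  obtain lam :: real where lam: "lam \<notin> \<rat>"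
    using countable_rat uncountable_UNIV_real by (metis UNIV_eq_I)
  have "countable ((\<lambda>(a, b). a + b * lam) ` (\<rat> \<times> \<rat>))"
    by (intro countable_image countable_SIGMA countable_rat)
  then obtain mu where "mu \<notin> (\<lambda>(a, b). a + b * lam) ` (\<rat> \<times> \<rat>)"
    using uncountable_UNIV_real by (metis UNIV_eq_I)
  with lam have "projected_quadric lam mu"
    by unfold_locales force+
  then show ?thesis by blast
qed

lemma half_le_nat_floor:
  fixes u :: real
  assumes "u \<ge> 1"
  shows "u / 2 \<le> real (nat \<lfloor>u\<rfloor>)"
proof -
  have "real (nat \<lfloor>u\<rfloor>) \<ge> 1"
    using assms by (simp add: le_nat_floor)
  moreover have "u < real (nat \<lfloor>u\<rfloor>) + 1"
    by linarith
  ultimately show ?thesis by linarith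
qed

lemma grid_incidences_ge:
  fixes \<kappa> \<rho> :: real
  assumes "\<kappa> \<ge> 0" "\<rho> \<ge> 0"
  shows "\<kappa> ^ 3 * \<rho> ^ 4 \<le>
    128 * (real (nat \<lfloor>\<kappa>\<rfloor>) ^ 3 * real (nat \<lfloor>\<rho>\<rfloor>) ^ 4) + \<kappa> ^ 3 * \<rho> ^ 3 + \<kappa>\<^sup>2 * \<rho> ^ 4"
    (is "_ \<le> 128 * ?I + _ + _")
proof -
  have nonneg: "?I \<ge> 0" "\<kappa> ^ 3 * \<rho> ^ 3 \<ge> 0" "\<kappa>\<^sup>2 * \<rho> ^ 4 \<ge> 0"
    using assms by simp_all
  consider (small_\<kappa>) "\<kappa> \<le> 1" | (small_\<rho>) "\<rho> \<le> 1" | (large) "\<kappa> \<ge> 1" "\<rho> \<ge> 1"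
    by linarith
  then show ?thesis
  proof cases
    case small_\<kappa>
    have "\<kappa> ^ 3 * \<rho> ^ 4 = (\<kappa>\<^sup>2 * \<rho> ^ 4) * \<kappa>"
      by (simp add: eval_nat_numeral)
    also have "\<dots> \<le> \<kappa>\<^sup>2 * \<rho> ^ 4"
      using small_\<kappa> nonneg by (intro mult_left_le)
    finally show ?thesis
      using nonneg by linarith
  next
    case small_\<rho>
    have "\<kappa> ^ 3 * \<rho> ^ 4 = (\<kappa> ^ 3 * \<rho> ^ 3) * \<rho>"
      by (simp add: eval_nat_numeral)
    also have "\<dots> \<le> \<kappa> ^ 3 * \<rho> ^ 3"
      using small_\<rho> nonneg by (intro mult_left_le)
    finally show ?thesis
      using nonneg by linarith
  next
    case large
    then have "(\<kappa> / 2) ^ 3 * (\<rho> / 2) ^ 4 \<le> ?I"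
      by (intro mult_mono power_mono half_le_nat_floor) auto
    then have "\<kappa> ^ 3 * \<rho> ^ 4 \<le> 128 * ?I"
      by (simp add: power_divide)
    then show ?thesis
      using nonneg by linarith
  qed
qed

lemma ex_grid_parameters:
  fixes m n :: nat
  assumes "m \<ge> 1" "n \<ge> 1"
  obtains k r :: nat where "4 * k ^ 3 * r ^ 3 \<le> m" "k\<^sup>2 * r ^ 4 \<le> n"
    and "real m powr (2/3) * real n powr (1/2)
      \<le> 1024 * real (k ^ 3 * r ^ 4) + real m + 2 * real n"
proof -
  define a b where "a = real m powr (1/3)" and "b = real n powr (1/2)"
  define \<kappa> \<rho> where "\<kappa> = a\<^sup>2 / (2 * b)" and "\<rho> = b / a"
  define k r where "k = nat \<lfloor>\<kappa>\<rfloor>" and "r = nat \<lfloor>\<rho>\<rfloor>"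
  have "a > 0" "b > 0"
    using assms by (simp_all add: a_def b_def)
  then have pos: "\<kappa> \<ge> 0" "\<rho> \<ge> 0"
    by (simp_all add: \<kappa>_def \<rho>_def)
  have "real m = a ^ 3" "real n = b\<^sup>2" "real m powr (2/3) = a\<^sup>2"
    using assms by (simp_all add: a_def b_def powr_power)
  then have m: "real m = 8 * \<kappa> ^ 3 * \<rho> ^ 3" and n: "real n = 4 * \<kappa>\<^sup>2 * \<rho> ^ 4"
    and product: "real m powr (2/3) * real n powr (1/2) = 8 * (\<kappa> ^ 3 * \<rho> ^ 4)"
    unfolding b_def[symmetric] \<kappa>_def \<rho>_def using \<open>a > 0\<close> \<open>b > 0\<close>
    by (simp_all add: field_simps eval_nat_numeral)
  have floor_le: "real k \<le> \<kappa>" "real r \<le> \<rho>"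
    unfolding k_def r_def using pos by (simp_all add: of_nat_floor)
  have "real (4 * k ^ 3 * r ^ 3) \<le> 8 * \<kappa> ^ 3 * \<rho> ^ 3"
    unfolding of_nat_mult of_nat_power of_nat_numeral
    by (intro mult_mono power_mono floor_le) (use pos in auto)
  then have "4 * k ^ 3 * r ^ 3 \<le> m"
    unfolding m[symmetric] of_nat_le_iff .
  moreover have "1 * real k ^ 2 * real r ^ 4 \<le> 4 * \<kappa>\<^sup>2 * \<rho> ^ 4"
    by (intro mult_mono power_mono floor_le) (use pos in auto)
  then have "real (k\<^sup>2 * r ^ 4) \<le> real n"
    by (simp add: n)
  then have "k\<^sup>2 * r ^ 4 \<le> n"
    unfolding of_nat_le_iff .
  moreover have "real m powr (2/3) * real n powr (1/2)
      \<le> 1024 * real (k ^ 3 * r ^ 4) + real m + 2 * real n"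
    using grid_incidences_ge[OF pos]
    unfolding product unfolding m n k_def r_def of_nat_mult of_nat_power by linarith
  ultimately show thesis by (rule that)
qed

lemma (in projected_quadric) incidences_attainable_lower_bound:
  assumes "m \<ge> 1" "n \<ge> 1"
  obtains N where "incidences_attainable rational_lines m n N"
    and "1 / 2048 * (real m powr (2/3) * real n powr (1/2) + real m + real n) \<le> real N"
proof -
  obtain k r where "4 * k ^ 3 * r ^ 3 \<le> m" "k\<^sup>2 * r ^ 4 \<le> n"
    and upper: "real m powr (2/3) * real n powr (1/2)
      \<le> 1024 * real (k ^ 3 * r ^ 4) + real m + 2 * real n"
    using ex_grid_parameters[OF assms] .
  then have "incidences_attainable rational_lines m n (k ^ 3 * r ^ 4)"
    by (intro incidences_attainable_grid)
  moreover have "incidences_attainable rational_lines m n n"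
    using infinite_rational_lines_through_origin assms(1) by (rule incidences_attainable_lines)
  moreover obtain l where "l \<in> rational_lines"
    using infinite_rational_lines by fastforce
  then have "incidences_attainable rational_lines m n m"
    using infinite_rational_lines assms(2)
    by (intro incidences_attainable_points infinite_is_line rational_line_is_line)
  moreover define N where "N = max (k ^ 3 * r ^ 4) (max m n)"
  ultimately have "incidences_attainable rational_lines m n N"
    by (simp add: max_def)
  moreover have "real (k ^ 3 * r ^ 4) \<le> real N" "real m \<le> real N" "real n \<le> real N"
    unfolding N_def of_nat_le_iff by simp_all
  then have "1 / 2048 * (real m powr (2/3) * real n powr (1/2) + real m + real n) \<le> real N"
    using upper by simp
  ultimately show thesis by (rule that)
qed

theorem theorem1p5:
  shows "\<exists>(C::nat) (c::real). c > 0 \<and>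
    (\<forall>(m::nat) (n::nat). m \<ge> 1 \<longrightarrow> n \<ge> 1 \<longrightarrow>
      (\<exists>(P :: (real ^ 3) set) (L :: (real ^ 3) set set).
         finite P \<and> card P = m \<and>
         finite L \<and> card L = n \<and> (\<forall>l\<in>L. is_line l) \<and>
         (\<forall>H. is_plane H \<longrightarrow> card {l \<in> L. l \<subseteq> H} \<le> C) \<and>
         real (incidences P L)
           \<ge> c * (real m powr (2/3) * real n powr (1/2) + real m + real n)))"
proof -
  obtain lam mu where "projected_quadric lam mu"
    using ex_projected_quadric by blast
  then interpret projected_quadric lam mu .
  show ?thesis
  proof (intro exI[of _ "2::nat"] exI[of _ "1 / 2048 :: real"] conjI allI impI)
    fix m n :: nat
    assume "m \<ge> 1" "n \<ge> 1"
    then obtain N where "incidences_attainable rational_lines m n N"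
      and N: "1 / 2048 * (real m powr (2/3) * real n powr (1/2) + real m + real n) \<le> real N"
      by (rule incidences_attainable_lower_bound)
    then obtain P L where PL: "finite P" "card P = m" "finite L" "card L = n" "L \<subseteq> rational_lines"
      and attained: "N \<le> incidences P L"
      unfolding incidences_attainable_def by blast
    then have "\<forall>l\<in>L. is_line l" "\<forall>H. is_plane H \<longrightarrow> card {l \<in> L. l \<subseteq> H} \<le> 2"
      using rational_line_is_line card_rational_lines_in_plane by blast+
    moreover have "1 / 2048 * (real m powr (2/3) * real n powr (1/2) + real m + real n)
        \<le> real (incidences P L)"
      using N attained by linarith
    ultimately show "\<exists>P L. finite P \<and> card P = m \<and> finite L \<and> card L = n \<and> (\<forall>l\<in>L. is_line l) \<and>
        (\<forall>H. is_plane H \<longrightarrow> card {l \<in> L. l \<subseteq> H} \<le> 2) \<and>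
        real (incidences P L)
          \<ge> 1 / 2048 * (real m powr (2/3) * real n powr (1/2) + real m + real n)"
      using PL by blast
  qed simp
qed

end
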